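(* Let $H$ be a target graph, possibly with loops. Suppose there is an ordering $H^1,\ldots,H^k$ of the automorphic similarity classes of $H$ such that the associated automorphic similarity matrix $M$ has the increasing columns property. Then $H$ is Hoffman-London.
   Context: All graphs are finite. A target graph $H$ is a graph without multiple edges but possibly with loops. For a simple loopless graph $G$, an $H$-coloring of $G$ is a map $f:V(G)\to V(H)$ such that $f(u)\sim_H f(v)$ whenever $u\sim_G v$; $\hom(G,H)$ denotes the number of $H$-colorings of $G$. $\mathcal{T}_n$ is the set of all trees on $n$ vertices (up to isomorphism) and $P_n\in\mathcal{T}_n$ is the path on $n$ vertices. $H$ is Hoffman-London if for all $n\ge 1$, $\hom(P_n,H)=\min_{T_n\in\mathcal{T}_n}\hom(T_n,H)$. Vertices $u,v$ of $H$ are automorphically similar if some automorphism of $H$ maps $u$ to $v$; this is an equivalence relation on $V(H)$, whose classes (the orbits of the automorphism group) are the automorphic similarity classes $H^1,\ldots,H^k$. For all $i,j$ every vertex of $H^i$ has the same number $m_{i,j}$ of neighbors in $H^j$ (a looped vertex is a neighbor of itself, counted once). The automorphic similarity matrix of $H$ relative to the ordering $H^1,\ldots,H^k$ is the $k\times k$ matrix $M$ with $(i,j)$-entry $m_{i,j}$. A $k\times k$ matrix $M=(m_{i,j})$ has the increasing columns property if for each $1\le c\le k$ and each $1\le i\le k-1$, $\sum_{j=c}^k m_{i,j}\le\sum_{j=c}^k m_{i+1,j}$. *)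

theory Defs
  imports "Graph_Theory.Graph_Theory" "Jordan_Normal_Form.Matrix"
begin

text \<open>
  Undirected graphs are symmetric digraphs without parallel arcs. A target graph is a
  \<^locale>\<open>pair_pseudo_graph\<close> (finite, symmetric, loops allowed); a loop at \<open>v\<close> is the single arc
  \<open>(v, v)\<close>. A simple loopless graph is a \<^locale>\<open>pair_graph\<close>.
\<close>

definition H_colorings :: "'a pair_pre_digraph \<Rightarrow> 'b pair_pre_digraph \<Rightarrow> ('a \<Rightarrow> 'b) set" where
  "H_colorings G H =
     {f \<in> pverts G \<rightarrow>\<^sub>E pverts H. \<forall>u v. (u, v) \<in> parcs G \<longrightarrow> (f u, f v) \<in> parcs H}"

definition hom_count :: "'a pair_pre_digraph \<Rightarrow> 'b pair_pre_digraph \<Rightarrow> nat" where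
  "hom_count G H = card (H_colorings G H)"

text \<open>
  The library's \<^const>\<open>tree\<close> is not usable for undirected graphs: in a symmetric digraph every
  edge yields a directed cycle \<open>u, v, u\<close> of length 2. A cycle of the undirected graph is a
  directed cycle of length at least 3.
\<close>

definition undirected_tree :: "'a pair_pre_digraph \<Rightarrow> bool" where
  "undirected_tree T \<longleftrightarrow>
     pair_graph T \<and> connected (with_proj T) \<and>
     \<not> (\<exists>p. pre_digraph.cycle (with_proj T) p \<and> length p \<ge> 3)"

text \<open>
  The labelled trees on \<open>{0, ..., n - 1}\<close>. Every tree on \<open>n\<close> vertices is isomorphic to one of
  them, and \<^const>\<open>hom_count\<close> is invariant under isomorphism of its first argument.
\<close>

definition trees :: "nat \<Rightarrow> nat pair_pre_digraph set" where
  "trees n = {T. undirected_tree T \<and> pverts T = {..<n}}"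

definition path_graph :: "nat \<Rightarrow> nat pair_pre_digraph" where
  "path_graph n =
     \<lparr> pverts = {..<n}, parcs = {(i, j). i < n \<and> j < n \<and> (j = Suc i \<or> i = Suc j)} \<rparr>"

definition hoffman_london :: "'a pair_pre_digraph \<Rightarrow> bool" where
  "hoffman_london H \<longleftrightarrow>
     (\<forall>n\<ge>1. hom_count (path_graph n) H = Min ((\<lambda>T. hom_count T H) ` trees n))"

definition automorphism ::
  "'a pair_pre_digraph \<Rightarrow> ('a, 'a \<times> 'a, 'a, 'a \<times> 'a) digraph_isomorphism \<Rightarrow> bool" where
  "automorphism H \<phi> \<longleftrightarrow>
     pre_digraph.digraph_isomorphism (with_proj H) \<phi> \<and> app_iso \<phi> (with_proj H) = with_proj H"

definition similarity :: "'a pair_pre_digraph \<Rightarrow> 'a rel" where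
  "similarity H =
     {(u, v). u \<in> pverts H \<and> v \<in> pverts H \<and> (\<exists>\<phi>. automorphism H \<phi> \<and> iso_verts \<phi> u = v)}"

definition similarity_classes :: "'a pair_pre_digraph \<Rightarrow> 'a set set" where
  "similarity_classes H = pverts H // similarity H"

definition class_ordering :: "'a pair_pre_digraph \<Rightarrow> 'a set list \<Rightarrow> bool" where
  "class_ordering H Hs \<longleftrightarrow> distinct Hs \<and> set Hs = similarity_classes H"

definition neighbors_in :: "'a pair_pre_digraph \<Rightarrow> 'a \<Rightarrow> 'a set \<Rightarrow> nat" where
  "neighbors_in H v B = card {w \<in> B. (v, w) \<in> parcs H}"

definition similarity_matrix :: "'a pair_pre_digraph \<Rightarrow> 'a set list \<Rightarrow> nat mat" where
  "similarity_matrix H Hs = mat (length Hs) (length Hs)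
     (\<lambda>(i, j). THE m. \<forall>v \<in> Hs ! i. neighbors_in H v (Hs ! j) = m)"

text \<open>Matrix indices start at 0.\<close>

definition increasing_columns :: "'a :: {comm_monoid_add, ord} mat \<Rightarrow> bool" where
  "increasing_columns M \<longleftrightarrow>
     square_mat M \<and>
     (\<forall>c < dim_row M. \<forall>i. Suc i < dim_row M \<longrightarrow>
        (\<Sum>j = c..<dim_row M. M $$ (i, j)) \<le> (\<Sum>j = c..<dim_row M. M $$ (Suc i, j)))"

text \<open>The minimum in \<^const>\<open>hoffman_london\<close> is over a finite set containing the path.\<close>

lemma finite_trees: "finite (trees n)"
proof -
  have "trees n \<subseteq> (\<lambda>E. \<lparr> pverts = {..<n}, parcs = E \<rparr>) ` Pow ({..<n} \<times> {..<n})"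
  proof
    fix T assume "T \<in> trees n"
    then have T: "pair_graph T" "pverts T = {..<n}"
      by (auto simp: trees_def undirected_tree_def)
    then interpret pair_graph T by simp
    have "parcs T \<in> Pow ({..<n} \<times> {..<n})"
      using T(2) by (auto dest: in_arcsD1 in_arcsD2)
    moreover have "T = \<lparr> pverts = {..<n}, parcs = parcs T \<rparr>"
      using T(2) by simp
    ultimately show "T \<in> (\<lambda>E. \<lparr> pverts = {..<n}, parcs = E \<rparr>) ` Pow ({..<n} \<times> {..<n})"
      by blast
  qed
  then show ?thesis
    by (rule finite_subset) auto
qed

lemma length_pawalk_verts: "length (pawalk_verts u p) = Suc (length p)"
  by (induct p arbitrary: u) auto

lemma pawalk_verts_nth_arc:
  assumes "pcas u p v" "i < length p"
  shows "p ! i = (pawalk_verts u p ! i, pawalk_verts u p ! Suc i)"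
  using assms
proof (induct p arbitrary: u i)
  case (Cons e p)
  show ?case
  proof (cases i)
    case 0
    have "pawalk_verts (snd e) p ! 0 = snd e"
      using Cons.prems by (cases p) auto
    with 0 Cons.prems show ?thesis by (auto simp: prod_eq_iff)
  next
    case (Suc k)
    with Cons show ?thesis by auto
  qed
qed simp

lemma path_graph_in_trees:
  assumes "n \<ge> 1"
  shows "path_graph n \<in> trees n"
proof -
  let ?P = "path_graph n"
  have V: "pverts ?P = {..<n}"
    and E: "(i, j) \<in> parcs ?P \<longleftrightarrow> i < n \<and> j < n \<and> (j = Suc i \<or> i = Suc j)" for i j
    by (auto simp: path_graph_def)
  have "parcs ?P \<subseteq> {..<n} \<times> {..<n}"
    by (auto simp: E)
  then have fin: "finite (parcs ?P)"
    by (rule finite_subset) auto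
  have pg: "pair_graph ?P"
    by unfold_locales (auto simp: V E fin symmetric_def intro!: symI)
  interpret P: pair_graph ?P by (rule pg)
  have from0: "0 \<rightarrow>\<^sup>*\<^bsub>with_proj ?P\<^esub> i" if "i < n" for i
    using that
  proof (induct i)
    case 0
    then show ?case using V by auto
  next
    case (Suc i)
    then have "(i, Suc i) \<in> parcs ?P" by (auto simp: E)
    with Suc show ?case by (intro P.reachable_adj_trans[of 0 i "Suc i"]) auto
  qed
  have sc: "strongly_connected (with_proj ?P)"
    unfolding strongly_connected_def
  proof (intro conjI ballI)
    show "verts (with_proj ?P) \<noteq> {}" using assms by (auto simp: V lessThan_empty_iff)
    fix u v assume "u \<in> verts (with_proj ?P)" "v \<in> verts (with_proj ?P)"
    then have "u < n" "v < n" by (auto simp: V)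
    then show "u \<rightarrow>\<^sup>*\<^bsub>with_proj ?P\<^esub> v"
      using from0 P.sym_arcs by (meson P.reachable_trans symmetric_reachable)
  qed
  have "parcs (mk_symmetric (with_proj ?P)) = parcs ?P"
    unfolding mk_symmetric_def by (auto simp: E)
  then have "mk_symmetric (with_proj ?P) = ?P"
    by (intro pair_pre_digraph.equality) (auto simp: mk_symmetric_def)
  with sc have con: "connected (with_proj ?P)"
    by (simp add: connected_def)
  have "\<not> (\<exists>p. pre_digraph.cycle (with_proj ?P) p \<and> length p \<ge> 3)"
  proof
    assume "\<exists>p. pre_digraph.cycle (with_proj ?P) p \<and> length p \<ge> 3"
    then obtain p u where p: "P.awalk u p u" "distinct (tl (pawalk_verts u p))" "length p \<ge> 3"
      unfolding P.cycle_def by auto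
    define L where "L = length p"
    define w where "w = (\<lambda>i. pawalk_verts u p ! i)"
    have L: "L \<ge> 3" using p by (simp add: L_def)
    have cas: "pcas u p u" and arcs: "set p \<subseteq> parcs ?P"
      using p(1) by (auto simp: P.awalk_def)
    have adj: "w (Suc i) = Suc (w i) \<or> w i = Suc (w (Suc i))" if "i < L" for i
    proof -
      have "p ! i \<in> parcs ?P" using arcs that by (auto simp: L_def)
      then show ?thesis
        using pawalk_verts_nth_arc[OF cas, of i] that by (auto simp: L_def w_def E)
    qed
    have w0: "w 0 = u" unfolding w_def using cas by (cases p) auto
    have last: "pcas a q b \<Longrightarrow> pawalk_verts a q ! length q = b" for a b :: nat and q
      by (induct q arbitrary: a) auto
    have wL: "w L = u" unfolding w_def L_def by (rule last[OF cas])
    have inj: "w (Suc i) \<noteq> w (Suc j)" if "i < L" "j < L" "i \<noteq> j" for i j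
      using p(2) that
      by (auto simp: w_def L_def length_pawalk_verts nth_tl distinct_conv_nth)
    define m where "m = Max (w ` {1..L})"
    have "m \<in> w ` {1..L}" unfolding m_def using L by (intro Max_in) auto
    then obtain i where i: "1 \<le> i" "i \<le> L" "w i = m" by auto
    have le: "w j \<le> m" if "j \<le> L" for j
    proof (cases "j = 0")
      case True
      have "w L \<le> m" unfolding m_def using L by (intro Max_ge) auto
      with True w0 wL show ?thesis by simp
    next
      case False
      with that show ?thesis unfolding m_def by (intro Max_ge) auto
    qed
    have prev: "m = Suc (w (i - 1))"
    proof -
      have "i - 1 < L" "i - 1 \<le> L" "Suc (i - 1) = i" using i L by linarith+
      with adj[of "i - 1"] le[of "i - 1"] i(3) show ?thesis by (metis not_less_eq_eq order_refl)
    qed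
    show False
    proof (cases "i = L")
      case True
      have "m = w 0" using True i w0 wL by simp
      then have "m = Suc (w 1)" using adj[of 0] le[of 1] L by auto
      moreover have "Suc (L - 2) = i - 1" using True L by linarith
      ultimately have "w (Suc 0) = w (Suc (L - 2))" using prev by simp
      with inj[of 0 "L - 2"] L show False by simp
    next
      case False
      with i have iL: "i < L" by simp
      then have nxt: "m = Suc (w (Suc i))"
        using adj[of i] le[of "Suc i"] i by auto
      show False
      proof (cases "i = 1")
        case True
        with prev nxt w0 wL have "w (Suc 1) = w (Suc (L - 1))" using L by simp
        with inj[of 1 "L - 1"] L show False by simp
      next
        case False
        with i have "Suc (i - 2) = i - 1" by linarith
        with prev nxt have "w (Suc i) = w (Suc (i - 2))" by simp
        moreover have "i - 2 < L" "i \<noteq> i - 2" using iL i(1) by linarith+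
        ultimately show False using inj[of i "i - 2"] iL by blast
      qed
    qed
  qed
  with pg con V show ?thesis
    by (simp add: trees_def undirected_tree_def)
qed

text \<open>
  Automorphisms are, up to their values outside the vertex set, the permutations of the vertices
  that preserve adjacency and non-adjacency.
\<close>

lemma automorphism_verts:
  assumes "automorphism H \<phi>"
  shows "bij_betw (iso_verts \<phi>) (pverts H) (pverts H)"
    and "\<And>u v. u \<in> pverts H \<Longrightarrow> v \<in> pverts H \<Longrightarrow>
           (iso_verts \<phi> u, iso_verts \<phi> v) \<in> parcs H \<longleftrightarrow> (u, v) \<in> parcs H"
proof -
  let ?f = "iso_verts \<phi>" and ?g = "iso_arcs \<phi>"
  have iso: "pre_digraph.digraph_isomorphism (with_proj H) \<phi>"
    and eq: "app_iso \<phi> (with_proj H) = with_proj H"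
    using assms by (auto simp: automorphism_def)
  have inj: "inj_on ?f (pverts H)" and wf: "wf_digraph (with_proj H)"
    using iso by (auto simp: pre_digraph.digraph_isomorphism_def)
  have V: "?f ` pverts H = pverts H" and A: "?g ` parcs H = parcs H"
    and t: "iso_tail \<phi> = fst" and h: "iso_head \<phi> = snd"
    using arg_cong[OF eq, of verts] arg_cong[OF eq, of arcs]
      arg_cong[OF eq, of tail] arg_cong[OF eq, of head] by auto
  show "bij_betw ?f (pverts H) (pverts H)"
    using inj V by (simp add: bij_betw_def)
  have g: "?g (a, b) = (?f a, ?f b)" if "(a, b) \<in> parcs H" for a b
    using iso that t h by (auto simp: pre_digraph.digraph_isomorphism_def prod_eq_iff)
  fix u v assume uv: "u \<in> pverts H" "v \<in> pverts H"
  show "(?f u, ?f v) \<in> parcs H \<longleftrightarrow> (u, v) \<in> parcs H"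
  proof
    assume "(u, v) \<in> parcs H"
    with g A show "(?f u, ?f v) \<in> parcs H" by (metis imageI)
  next
    assume "(?f u, ?f v) \<in> parcs H"
    then obtain a b where ab: "(a, b) \<in> parcs H" "(?f u, ?f v) = ?g (a, b)"
      using A by (metis imageE prod.collapse)
    then have "?f u = ?f a" "?f v = ?f b" using g by auto
    moreover have "a \<in> pverts H" "b \<in> pverts H"
      using wf_digraph.tail_in_verts[OF wf, of "(a, b)"]
        wf_digraph.head_in_verts[OF wf, of "(a, b)"] ab(1) by auto
    ultimately have "u = a" "v = b" using inj uv by (auto dest: inj_onD)
    with ab show "(u, v) \<in> parcs H" by simp
  qed
qed

lemma automorphismI:
  assumes H: "pair_wf_digraph H" and bij: "bij_betw f (pverts H) (pverts H)"
    and adj: "\<And>u v. u \<in> pverts H \<Longrightarrow> v \<in> pverts H \<Longrightarrow> (f u, f v) \<in> parcs H \<longleftrightarrow> (u, v) \<in> parcs H"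
  shows "automorphism H \<lparr> iso_verts = f, iso_arcs = map_prod f f, iso_head = snd, iso_tail = fst \<rparr>"
proof -
  interpret pair_wf_digraph H by (rule H)
  have sub: "parcs H \<subseteq> pverts H \<times> pverts H"
    by (auto dest: in_arcsD1 in_arcsD2)
  have inj: "inj_on f (pverts H)" and V: "f ` pverts H = pverts H"
    using bij by (auto simp: bij_betw_def)
  have "inj_on (map_prod f f) (parcs H)"
    using inj_on_subset[OF map_prod_inj_on[OF inj inj] sub] .
  moreover have "map_prod f f ` parcs H = parcs H"
  proof
    show "map_prod f f ` parcs H \<subseteq> parcs H" using adj sub by auto
    show "parcs H \<subseteq> map_prod f f ` parcs H"
    proof
      fix e assume e: "e \<in> parcs H"
      obtain c d where cd: "e = (c, d)" by (cases e)
      with e sub have "c \<in> f ` pverts H" "d \<in> f ` pverts H" using V by auto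
      then obtain a b where "a \<in> pverts H" "b \<in> pverts H" "c = f a" "d = f b" by auto
      with cd e adj have "(a, b) \<in> parcs H" "e = map_prod f f (a, b)" by auto
      then show "e \<in> map_prod f f ` parcs H" by blast
    qed
  qed
  ultimately show ?thesis
    using inj V wf_digraph
    by (auto simp: automorphism_def pre_digraph.digraph_isomorphism_def app_iso_def with_proj_def)
qed

lemma similarity_iff:
  assumes "pair_wf_digraph H"
  shows "(u, v) \<in> similarity H \<longleftrightarrow>
    u \<in> pverts H \<and> v \<in> pverts H \<and>
    (\<exists>f. bij_betw f (pverts H) (pverts H) \<and> f u = v \<and>
      (\<forall>x \<in> pverts H. \<forall>y \<in> pverts H. (f x, f y) \<in> parcs H \<longleftrightarrow> (x, y) \<in> parcs H))"
  (is "?L \<longleftrightarrow> ?R")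
proof
  assume ?L
  then obtain \<phi> where "u \<in> pverts H" "v \<in> pverts H" "automorphism H \<phi>" "iso_verts \<phi> u = v"
    by (auto simp: similarity_def)
  with automorphism_verts[OF this(3)] show ?R by auto
next
  assume R: ?R
  then obtain f where "bij_betw f (pverts H) (pverts H)" "f u = v"
    "\<And>x y. x \<in> pverts H \<Longrightarrow> y \<in> pverts H \<Longrightarrow> (f x, f y) \<in> parcs H \<longleftrightarrow> (x, y) \<in> parcs H"
    by blast
  with R automorphismI[OF assms this(1,3)] show ?L
    by (force simp: similarity_def)
qed

lemma equiv_similarity:
  assumes "pair_wf_digraph H"
  shows "equiv (pverts H) (similarity H)"
proof (rule equivI)
  show "similarity H \<subseteq> pverts H \<times> pverts H"
    by (auto simp: similarity_def)
  show "refl_on (pverts H) (similarity H)"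
    by (rule refl_onI) (auto simp: similarity_iff[OF assms] intro!: exI[of _ id])
  show "sym (similarity H)"
  proof (rule symI)
    fix u v assume "(u, v) \<in> similarity H"
    then obtain f where f: "u \<in> pverts H" "v \<in> pverts H" "bij_betw f (pverts H) (pverts H)" "f u = v"
      "\<And>x y. x \<in> pverts H \<Longrightarrow> y \<in> pverts H \<Longrightarrow> (f x, f y) \<in> parcs H \<longleftrightarrow> (x, y) \<in> parcs H"
      unfolding similarity_iff[OF assms] by blast
    let ?g = "the_inv_into (pverts H) f"
    have g: "bij_betw ?g (pverts H) (pverts H)"
      using f(3) by (rule bij_betw_the_inv_into)
    moreover have "?g v = u"
      using f by (metis bij_betw_imp_inj_on the_inv_into_f_f)
    moreover have "(?g x, ?g y) \<in> parcs H \<longleftrightarrow> (x, y) \<in> parcs H"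
      if "x \<in> pverts H" "y \<in> pverts H" for x y
    proof -
      have "f (?g x) = x" "f (?g y) = y"
        using f(3) that by (auto intro: f_the_inv_into_f_bij_betw)
      moreover have "?g x \<in> pverts H" "?g y \<in> pverts H"
        using g that by (auto simp: bij_betw_apply)
      ultimately show ?thesis using f(5)[of "?g x" "?g y"] by simp
    qed
    ultimately show "(v, u) \<in> similarity H"
      unfolding similarity_iff[OF assms] using f(1,2) by blast
  qed
  show "trans (similarity H)"
  proof (rule transI)
    fix u v w assume "(u, v) \<in> similarity H" "(v, w) \<in> similarity H"
    then obtain f g where f: "u \<in> pverts H" "w \<in> pverts H" "bij_betw f (pverts H) (pverts H)" "f u = v"
      "\<And>x y. x \<in> pverts H \<Longrightarrow> y \<in> pverts H \<Longrightarrow> (f x, f y) \<in> parcs H \<longleftrightarrow> (x, y) \<in> parcs H"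
      and g: "bij_betw g (pverts H) (pverts H)" "g v = w"
      "\<And>x y. x \<in> pverts H \<Longrightarrow> y \<in> pverts H \<Longrightarrow> (g x, g y) \<in> parcs H \<longleftrightarrow> (x, y) \<in> parcs H"
      unfolding similarity_iff[OF assms] by blast
    have "bij_betw (g \<circ> f) (pverts H) (pverts H)" using f(3) g(1) by (rule bij_betw_trans)
    moreover have "((g \<circ> f) x, (g \<circ> f) y) \<in> parcs H \<longleftrightarrow> (x, y) \<in> parcs H"
      if "x \<in> pverts H" "y \<in> pverts H" for x y
      using f(3,5) g(3) that by (simp add: bij_betw_apply)
    ultimately show "(u, w) \<in> similarity H"
      unfolding similarity_iff[OF assms] using f(1,2,4) g(2)
      by (intro conjI exI[of _ "g \<circ> f"]) auto
  qed
qed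

text \<open>The definite description in \<^const>\<open>similarity_matrix\<close> is well-defined.\<close>

lemma neighbors_in_class_eq:
  assumes H: "pair_pseudo_graph H"
    and A: "A \<in> similarity_classes H" and B: "B \<in> similarity_classes H"
    and u: "u \<in> A" and v: "v \<in> A"
  shows "neighbors_in H u B = neighbors_in H v B"
proof -
  interpret pair_pseudo_graph H by (rule H)
  have wf: "pair_wf_digraph H" by unfold_locales
  note eqv = equiv_similarity[OF wf]
  have "(u, v) \<in> similarity H"
    using quotient_eq_iff[OF eqv A[unfolded similarity_classes_def]
        A[unfolded similarity_classes_def] u v] by simp
  then obtain f where f: "u \<in> pverts H" "v \<in> pverts H" "bij_betw f (pverts H) (pverts H)" "f u = v"
    "\<And>x y. x \<in> pverts H \<Longrightarrow> y \<in> pverts H \<Longrightarrow> (f x, f y) \<in> parcs H \<longleftrightarrow> (x, y) \<in> parcs H"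
    unfolding similarity_iff[OF wf] by blast
  have BV: "B \<subseteq> pverts H"
    using B in_quotient_imp_subset[OF eqv] by (simp add: similarity_classes_def)
  have fB: "f x \<in> B \<longleftrightarrow> x \<in> B" if "x \<in> pverts H" for x
  proof -
    have "(x, f x) \<in> similarity H"
      unfolding similarity_iff[OF wf] using f(3,5) that by (auto simp: bij_betw_apply)
    then show ?thesis
      using in_quotient_imp_closed[OF eqv B[unfolded similarity_classes_def]] eqv
      by (meson equivE symE)
  qed
  have "bij_betw f {w \<in> B. (u, w) \<in> parcs H} {w \<in> B. (v, w) \<in> parcs H}"
    unfolding bij_betw_def
  proof
    show "inj_on f {w \<in> B. (u, w) \<in> parcs H}"
      using f(3) BV by (auto simp: bij_betw_def intro: inj_on_subset)
    show "f ` {w \<in> B. (u, w) \<in> parcs H} = {w \<in> B. (v, w) \<in> parcs H}"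
    proof
      show "f ` {w \<in> B. (u, w) \<in> parcs H} \<subseteq> {w \<in> B. (v, w) \<in> parcs H}"
        using f BV fB by auto
      show "{w \<in> B. (v, w) \<in> parcs H} \<subseteq> f ` {w \<in> B. (u, w) \<in> parcs H}"
      proof
        fix w assume w: "w \<in> {w \<in> B. (v, w) \<in> parcs H}"
        then obtain x where x: "x \<in> pverts H" "w = f x"
          using f(3) BV by (auto simp: bij_betw_def)
        with w f fB have "x \<in> {w \<in> B. (u, w) \<in> parcs H}" by auto
        with x show "w \<in> f ` {w \<in> B. (u, w) \<in> parcs H}" by blast
      qed
    qed
  qed
  then show ?thesis
    unfolding neighbors_in_def by (rule bij_betw_same_card)
qed

lemma similarity_matrix_entry:
  assumes H: "pair_pseudo_graph H" and Hs: "class_ordering H Hs"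
    and ij: "i < length Hs" "j < length Hs" and v: "v \<in> Hs ! i"
  shows "similarity_matrix H Hs $$ (i, j) = neighbors_in H v (Hs ! j)"
proof -
  have "Hs ! i \<in> similarity_classes H" "Hs ! j \<in> similarity_classes H"
    using Hs nth_mem[OF ij(1)] nth_mem[OF ij(2)] unfolding class_ordering_def by simp_all
  then have const: "neighbors_in H u (Hs ! j) = neighbors_in H v (Hs ! j)" if "u \<in> Hs ! i" for u
    by (rule neighbors_in_class_eq[OF H _ _ that v])
  have "(THE m. \<forall>v \<in> Hs ! i. neighbors_in H v (Hs ! j) = m) = neighbors_in H v (Hs ! j)"
  proof (rule the_equality)
    show "\<forall>u \<in> Hs ! i. neighbors_in H u (Hs ! j) = neighbors_in H v (Hs ! j)"
      by (intro ballI const)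
  next
    fix m assume "\<forall>u \<in> Hs ! i. neighbors_in H u (Hs ! j) = m"
    from bspec[OF this v] show "m = neighbors_in H v (Hs ! j)" ..
  qed
  with ij show ?thesis by (simp add: similarity_matrix_def)
qed

end

theory Submission
  imports Defs
begin

text \<open>
  Let \<open>N\<close> be the adjacency operator of \<open>H\<close>. The increasing columns property says that \<open>N\<close> preserves
  functions on \<open>V(H)\<close> that increase along the classes; pointwise products preserve them too, so
  the function \<open>h\<close> counting the colorings of a rooted tree by the color of the root is increasing.
  For a tree on \<open>n\<close> vertices and every increasing \<open>a\<close> we get
  \<open>\<langle>a, h\<rangle> \<ge> \<langle>a, N\<^sup>n\<^sup>-\<^sup>1 1\<rangle>\<close>, with equality for the path rooted at an end, by splitting the tree at an
  edge at the root into rooted trees on \<open>n - k\<close> and \<open>k\<close> vertices with functions \<open>g\<close> and \<open>h'\<close>: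
  \<open>\<langle>a, g \<cdot> N h'\<rangle> = \<langle>N (a g), h'\<rangle> \<ge> \<langle>N (a g), N\<^sup>k\<^sup>-\<^sup>1 1\<rangle> = \<langle>a g, N\<^sup>k 1\<rangle> \<ge> \<langle>N\<^sup>k a, g\<rangle> \<ge>
  \<langle>N\<^sup>k a, N\<^sup>n\<^sup>-\<^sup>k\<^sup>-\<^sup>1 1\<rangle>\<close>. The middle inequality is Chebyshev's sum inequality for the
  comonotone functions \<open>a\<close>, \<open>g\<close> and the symmetric kernel of \<open>N\<^sup>k\<close>.
\<close>

section \<open>Trees as relations\<close>

text \<open>The last condition says that every edge is a bridge, which replaces acyclicity.\<close>

definition bridge_tree :: "'v set \<Rightarrow> 'v rel \<Rightarrow> bool" where
  "bridge_tree V E \<longleftrightarrow> finite V \<and> E \<subseteq> V \<times> V \<and> sym E \<and> (\<forall>u\<in>V. \<forall>v\<in>V. (u, v) \<in> E\<^sup>*) \<and>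
     (\<forall>r s. (r, s) \<in> E \<longrightarrow> (r, s) \<notin> (E - {(r, s), (s, r)})\<^sup>*)"

text \<open>Every vertex of a walk starting at \<open>r\<close> is itself reachable from
  \<open>r\<close>, so the walk never leaves the component.\<close>

lemma rtrancl_Image_restrict:
  assumes "(r, v) \<in> E\<^sup>*"
  shows "(r, v) \<in> (E \<inter> (E\<^sup>* `` {r}) \<times> (E\<^sup>* `` {r}))\<^sup>*"
  using assms
proof induction
  case (step y z)
  have "(y, z) \<in> E \<inter> (E\<^sup>* `` {r}) \<times> (E\<^sup>* `` {r})"
    using step.hyps by (auto intro: rtrancl_into_rtrancl)
  with step.IH show ?case by (rule rtrancl_into_rtrancl)
qed simp

text \<open>Bridges survive in a subrelation: with fewer edges there are fewer walks that could
  bypass a deleted edge.\<close>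

lemma bridge_tree_component:
  assumes T: "bridge_tree V E" and F: "F \<subseteq> E" "sym F" and r: "r \<in> V"
  shows "bridge_tree (F\<^sup>* `` {r}) (F \<inter> (F\<^sup>* `` {r}) \<times> (F\<^sup>* `` {r}))"
    (is "bridge_tree ?C ?D")
proof -
  have "v \<in> V" if "(r, v) \<in> F\<^sup>*" for v
    using that r F(1) T by induction (auto simp: bridge_tree_def)
  then have "finite ?C"
    using T by (auto simp: bridge_tree_def intro: finite_subset[of _ V])
  moreover have sym: "sym ?D"
    using F(2) by (auto simp: sym_def)
  moreover have "(u, v) \<in> ?D\<^sup>*" if "u \<in> ?C" "v \<in> ?C" for u v
  proof -
    have "(r, u) \<in> ?D\<^sup>*" "(r, v) \<in> ?D\<^sup>*"
      using that rtrancl_Image_restrict[of r _ F] by auto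
    then show ?thesis
      using sym_rtrancl[OF sym] by (meson rtrancl_trans symD)
  qed
  moreover have "(a, b) \<notin> (?D - {(a, b), (b, a)})\<^sup>*" if "(a, b) \<in> ?D" for a b
  proof -
    have "(a, b) \<notin> (E - {(a, b), (b, a)})\<^sup>*"
      using T F(1) that by (auto simp: bridge_tree_def)
    moreover have "?D - {(a, b), (b, a)} \<subseteq> E - {(a, b), (b, a)}"
      using F(1) by auto
    ultimately show ?thesis
      using rtrancl_mono by blast
  qed
  ultimately show ?thesis
    by (auto simp: bridge_tree_def)
qed

text \<open>Delete one edge \<open>(r, s)\<close> at the root. As it is a bridge, the components of
  \<open>r\<close> and \<open>s\<close> are disjoint; they are the two smaller rooted trees of the
  main induction.\<close>

lemma bridge_tree_split:
  assumes T: "bridge_tree V E" and r: "r \<in> V" and ne: "V \<noteq> {r}"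
  obtains V1 E1 V2 E2 s where
    "bridge_tree V1 E1" "bridge_tree V2 E2" "V1 \<inter> V2 = {}" "V = V1 \<union> V2"
    "E = E1 \<union> E2 \<union> {(r, s), (s, r)}" "r \<in> V1" "s \<in> V2"
proof -
  have EV: "E \<subseteq> V \<times> V" and symE: "sym E"
    and conn: "\<And>u v. u \<in> V \<Longrightarrow> v \<in> V \<Longrightarrow> (u, v) \<in> E\<^sup>*"
    using T by (auto simp: bridge_tree_def)
  obtain v where "v \<in> V" "v \<noteq> r" using r ne by blast
  with conn[OF r] obtain s where s: "(r, s) \<in> E"
    by (metis converse_rtranclE)
  define F where "F = E - {(r, s), (s, r)}"
  have symF: "sym F" using symE by (auto simp: F_def sym_def)
  have bridge: "(r, s) \<notin> F\<^sup>*" using T s by (auto simp: bridge_tree_def F_def)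
  let ?V1 = "F\<^sup>* `` {r}" and ?V2 = "F\<^sup>* `` {s}"
  have disj: "?V1 \<inter> ?V2 = {}"
  proof -
    have False if "(r, v) \<in> F\<^sup>*" "(s, v) \<in> F\<^sup>*" for v
      using that bridge sym_rtrancl[OF symF] by (meson rtrancl_trans symD)
    then show ?thesis by auto
  qed
  \<comment> \<open>Follow the walk: a step in \<open>F\<close> stays in its component, and any
    other step ends in \<open>r\<close> or \<open>s\<close>.\<close>
  have "v \<in> ?V1 \<union> ?V2" if "(r, v) \<in> E\<^sup>*" for v
    using that
  proof induction
    case (step y z)
    show ?case
    proof (cases "(y, z) \<in> F")
      case True
      with step.IH show ?thesis by (auto intro: rtrancl_into_rtrancl)
    next
      case False
      with step.hyps show ?thesis by (auto simp: F_def)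
    qed
  qed simp
  moreover have "v \<in> V" if "(u, v) \<in> F\<^sup>*" "u \<in> V" for u v
    using that EV by induction (auto simp: F_def)
  ultimately have V: "V = ?V1 \<union> ?V2"
    using conn r s EV by blast
  have "F \<subseteq> (F \<inter> ?V1 \<times> ?V1) \<union> (F \<inter> ?V2 \<times> ?V2)"
  proof (rule subrelI)
    fix y z assume yz: "(y, z) \<in> F"
    then have "y \<in> ?V1 \<union> ?V2" using EV V by (auto simp: F_def)
    with yz show "(y, z) \<in> (F \<inter> ?V1 \<times> ?V1) \<union> (F \<inter> ?V2 \<times> ?V2)"
      by (auto intro: rtrancl_into_rtrancl)
  qed
  then have "E = (F \<inter> ?V1 \<times> ?V1) \<union> (F \<inter> ?V2 \<times> ?V2) \<union> {(r, s), (s, r)}"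
    using s symE by (auto simp: F_def sym_def)
  moreover have "F \<subseteq> E" "s \<in> V" using s EV by (auto simp: F_def)
  ultimately show thesis
    using that[of ?V1 _ ?V2 _ s] bridge_tree_component[OF T _ symF] r V disj by blast
qed

text \<open>If an edge is not a bridge, a path between its ends that avoids it closes up with it to
  a forbidden cycle.\<close>

lemma undirected_tree_bridge_tree:
  assumes "undirected_tree T"
  shows "bridge_tree (pverts T) (parcs T)"
proof -
  interpret pair_graph T using assms by (simp add: undirected_tree_def)
  have "strongly_connected (with_proj T)"
    using assms symmetric_connected_imp_strongly_connected sym_arcs
    by (simp add: undirected_tree_def)
  then have "(u, v) \<in> (parcs T)\<^sup>*" if "u \<in> pverts T" "v \<in> pverts T" for u v
    using that reachable_rtranclI[of "with_proj T" u v]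
    by (simp add: strongly_connected_def arcs_ends_def arc_to_ends_def)
  moreover have "sym (parcs T)"
    using arcs_symmetric by (auto intro: symI)
  moreover have "(r, s) \<notin> (parcs T - {(r, s), (s, r)})\<^sup>*" if rs: "(r, s) \<in> parcs T" for r s
  proof
    define F where "F = parcs T - {(r, s), (s, r)}"
    assume "(r, s) \<in> (parcs T - {(r, s), (s, r)})\<^sup>*"
    then have walk: "(r, s) \<in> F\<^sup>*" by (simp add: F_def)
    \<comment> \<open>Viewing the remaining arcs as a digraph allows the walk to be shortened to a
      path with distinct vertices.\<close>
    define G where "G = \<lparr>pverts = pverts T, parcs = F\<rparr>"
    interpret G: pair_wf_digraph G
      by unfold_locales (auto simp: G_def F_def dest: in_arcsD1 in_arcsD2)
    have "r \<rightarrow>\<^sup>*\<^bsub>with_proj G\<^esub> s"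
      using walk
    proof induction
      case base
      show ?case using rs by (intro G.reachable_refl) (auto simp: G_def dest: in_arcsD1)
    next
      case (step y z)
      then show ?case by (intro G.reachable_adj_trans[of r y z]) (auto simp: G_def)
    qed
    then obtain p where p: "G.apath r p s"
      using G.reachable_apath by blast
    then have cas: "pcas r p s" and dist: "distinct (pawalk_verts r p)" and sub: "set p \<subseteq> F"
      using G.apath_def G.awalk_def by (auto simp: G_def)
    have verts: "pawalk_verts a (q @ [(b, c)]) = pawalk_verts a q @ [c]" if "pcas a q b" 
      for a b c :: 'a and q
      using that by (induction q arbitrary: a) auto
    have "(s, r) \<in> parcs T" using rs arcs_symmetric by blast
    moreover have "pcas r (p @ [(s, r)]) r"
      using cas by (induction p arbitrary: r) auto
    ultimately have "awalk r (p @ [(s, r)]) r"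
      using sub rs by (auto simp: awalk_def F_def dest: in_arcsD1)
    \<comment> \<open>The closed walk repeats only \<open>r\<close>, at its two ends, and
      \<open>tl\<close> drops the first occurrence.\<close>
    moreover obtain vs where "pawalk_verts r p = r # vs"
      using cas by (cases p) auto
    with dist have "distinct (tl (pawalk_verts r (p @ [(s, r)])))"
      by (simp add: verts[OF cas])
    \<comment> \<open>An empty \<open>p\<close> would make the edge a loop, and a single arc would
      be the deleted \<open>(r, s)\<close>.\<close>
    moreover have "length (p @ [(s, r)]) \<ge> 3"
    proof (rule ccontr)
      assume "\<not> ?thesis"
      then consider "p = []" | e where "p = [e]"
        by (cases p rule: remdups_adj.cases) auto
      then show False
        using cas sub rs no_loops' by cases (auto simp: F_def)
    qed
    ultimately have "cycle (p @ [(s, r)]) \<and> length (p @ [(s, r)]) \<ge> 3"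
      unfolding cycle_def awalk_verts_with_proj_eq by blast
    then show False
      using assms unfolding undirected_tree_def by blast
  qed
  ultimately show ?thesis
    by (auto simp: bridge_tree_def dest: in_arcsD1 in_arcsD2)
qed

section \<open>Colorings\<close>

text \<open>Greedy matching: pair an element \<open>s\<close> of \<open>S\<close> of greatest
  \<kappa> with some \<open>t\<close> in \<open>T\<close> at least as high, remove both and recurse.
  Elements of \<open>T\<close> left over only add to its sum.\<close>

lemma sum_le_sum_if_tails_le:
  fixes f :: "'b \<Rightarrow> nat" and \<kappa> :: "'b \<Rightarrow> nat"
  assumes "finite S" "finite T"
    and "monotone_on (S \<union> T) (\<lambda>u v. \<kappa> u \<le> \<kappa> v) (\<le>) f"
    and "\<And>c. card {y \<in> S. c \<le> \<kappa> y} \<le> card {y \<in> T. c \<le> \<kappa> y}"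
  shows "sum f S \<le> sum f T"
  using assms
proof (induction "card S" arbitrary: S T)
  case (Suc n)
  have "finite (\<kappa> ` S)" "\<kappa> ` S \<noteq> {}" using Suc by auto
  then have "Max (\<kappa> ` S) \<in> \<kappa> ` S" by (rule Max_in)
  then obtain s where s: "s \<in> S" "\<kappa> s = Max (\<kappa> ` S)" by auto
  have smax: "\<kappa> y \<le> \<kappa> s" if "y \<in> S" for y using that s Suc.prems(1) by simp
  have "card {y \<in> S. \<kappa> s \<le> \<kappa> y} > 0" using s Suc.prems(1) by (auto simp: card_gt_0_iff)
  with Suc.prems(4)[of "\<kappa> s"] have "card {y \<in> T. \<kappa> s \<le> \<kappa> y} > 0" by linarith
  then obtain t where t: "t \<in> T" "\<kappa> s \<le> \<kappa> t" by (auto simp: card_gt_0_iff)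
  have drop: "card {y \<in> X - {x}. c \<le> \<kappa> y} = card {y \<in> X. c \<le> \<kappa> y} - (if c \<le> \<kappa> x then 1 else 0)"
    if "x \<in> X" "finite X" for X x c
  proof (cases "c \<le> \<kappa> x")
    case True
    then have "{y \<in> X - {x}. c \<le> \<kappa> y} = {y \<in> X. c \<le> \<kappa> y} - {x}" by auto
    with True that show ?thesis by simp
  next
    case False
    then have "{y \<in> X - {x}. c \<le> \<kappa> y} = {y \<in> X. c \<le> \<kappa> y}" by auto
    with False show ?thesis by simp
  qed
  have "sum f (S - {s}) \<le> sum f (T - {t})"
  proof (rule Suc.hyps(1))
    show "n = card (S - {s})" using Suc s by simp
    show "monotone_on (S - {s} \<union> (T - {t})) (\<lambda>u v. \<kappa> u \<le> \<kappa> v) (\<le>) f"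
      using Suc.prems(3) by (rule monotone_on_subset) auto
    fix c
    show "card {y \<in> S - {s}. c \<le> \<kappa> y} \<le> card {y \<in> T - {t}. c \<le> \<kappa> y}"
    \<comment> \<open>For \<open>c \<le> \<kappa> s \<le> \<kappa> t\<close> both counts lose
      exactly one; for larger \<open>c\<close> nothing of \<open>S\<close> is counted, by maximality
      of \<open>s\<close>.\<close>
    proof (cases "c \<le> \<kappa> s")
      case True
      with t show ?thesis
        unfolding drop[OF s(1) Suc.prems(1)] drop[OF t(1) Suc.prems(2)]
        by (simp add: Suc.prems(4) diff_le_mono)
    next
      case False
      with smax have "{y \<in> S - {s}. c \<le> \<kappa> y} = {}" by fastforce
      then show ?thesis by (simp only: card.empty)
    qed
  qed (use Suc.prems in auto)
  moreover have "f s \<le> f t"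
    using Suc.prems(3) s t by (auto simp: monotone_on_def)
  ultimately show ?case
    using s t Suc.prems by (simp add: sum.remove)
qed simp

section \<open>The adjacency operator of the target\<close>

text \<open>\<kappa> stands for the position of a vertex's class in the ordering;
  \<open>tails\<close> is then the increasing columns property read vertex by vertex, free of
  automorphisms and matrices.\<close>

locale ordered_target =
  fixes W :: "'b set" and A :: "'b rel" and \<kappa> :: "'b \<Rightarrow> nat"
  assumes finite_W: "finite W" and A_sub: "A \<subseteq> W \<times> W" and sym_A: "sym A"
    and tails: "\<And>u v c. u \<in> W \<Longrightarrow> v \<in> W \<Longrightarrow> \<kappa> u \<le> \<kappa> v \<Longrightarrow>
      card {w \<in> A `` {u}. c \<le> \<kappa> w} \<le> card {w \<in> A `` {v}. c \<le> \<kappa> w}"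
begin

text \<open>Equal \<kappa> gives inequalities both ways, so these functions are also constant on the
  classes.\<close>

abbreviation up :: "('b \<Rightarrow> nat) \<Rightarrow> bool" where
  "up \<equiv> monotone_on W (\<lambda>u v. \<kappa> u \<le> \<kappa> v) (\<le>)"

definition nbsum :: "('b \<Rightarrow> nat) \<Rightarrow> 'b \<Rightarrow> nat" where
  "nbsum f x = (\<Sum>y \<in> A `` {x}. f y)"

definition colorings :: "'v set \<Rightarrow> 'v rel \<Rightarrow> ('v \<Rightarrow> 'b) set" where
  "colorings V E = {f \<in> V \<rightarrow>\<^sub>E W. \<forall>u v. (u, v) \<in> E \<longrightarrow> (f u, f v) \<in> A}"

definition rooted_count :: "'v set \<Rightarrow> 'v rel \<Rightarrow> 'v \<Rightarrow> 'b \<Rightarrow> nat" where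
  "rooted_count V E r x = card {f \<in> colorings V E. f r = x}"

lemma finite_nb: "finite (A `` {x})"
  using A_sub finite_W by (auto intro: finite_subset[of _ W])

lemma nbsum_eq: "nbsum f x = (\<Sum>y\<in>W. of_bool ((x, y) \<in> A) * f y)"
proof -
  have "A `` {x} = {y \<in> W. (x, y) \<in> A}" using A_sub by auto
  then show ?thesis
    by (simp add: nbsum_def finite_W sum.If_cases of_bool_def if_distrib[of "\<lambda>t. t * _"] Int_def
        cong: if_cong)
qed

lemma nbsum_cong: "(\<And>y. y \<in> W \<Longrightarrow> f y = g y) \<Longrightarrow> nbsum f = nbsum g"
  unfolding nbsum_eq by (intro ext sum.cong) auto

text \<open>Both sides are a double sum over the arcs, read from opposite ends.\<close>

lemma nbsum_adjoint: "(\<Sum>x\<in>W. a x * nbsum b x) = (\<Sum>x\<in>W. nbsum a x * b x)"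
proof -
  have "(\<Sum>x\<in>W. a x * nbsum b x) = (\<Sum>x\<in>W. \<Sum>y\<in>W. of_bool ((x, y) \<in> A) * (a x * b y))"
    by (simp add: nbsum_eq sum_distrib_left mult_ac)
  also have "\<dots> = (\<Sum>y\<in>W. \<Sum>x\<in>W. of_bool ((y, x) \<in> A) * (a x * b y))"
    using sym_A by (subst sum.swap) (auto intro!: sum.cong simp: sym_def)
  also have "\<dots> = (\<Sum>y\<in>W. nbsum a y * b y)"
    by (simp add: nbsum_eq sum_distrib_left mult_ac)
  finally show ?thesis .
qed

lemma funpow_nbsum_adjoint:
  "(\<Sum>x\<in>W. a x * (nbsum ^^ k) b x) = (\<Sum>x\<in>W. (nbsum ^^ k) a x * b x)"
proof (induction k arbitrary: a)
  case (Suc k)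
  then show ?case
    by (simp add: nbsum_adjoint funpow_swap1[of nbsum k a])
qed simp

text \<open>This is where \<open>tails\<close> enters: passing to a higher vertex moves its
  neighborhood upwards.\<close>

lemma up_nbsum:
  assumes "up f"
  shows "up (nbsum f)"
proof (rule monotone_onI)
  fix u v assume "u \<in> W" "v \<in> W" "\<kappa> u \<le> \<kappa> v"
  with finite_nb tails show "nbsum f u \<le> nbsum f v"
    unfolding nbsum_def
    by (intro sum_le_sum_if_tails_le[where \<kappa> = \<kappa>] monotone_on_subset[OF assms])
      (use A_sub in auto)
qed

lemma up_funpow_nbsum: "up f \<Longrightarrow> up ((nbsum ^^ k) f)"
  by (induction k) (auto intro: up_nbsum)

lemma up_mult: "up f \<Longrightarrow> up g \<Longrightarrow> up (\<lambda>x. f x * g x)"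
  by (auto simp: monotone_on_def intro: mult_le_mono)

text \<open>The iterate at the indicator of \<open>v\<close>, evaluated at \<open>u\<close>, is the
  entry of the \<open>k\<close>-th power of the adjacency matrix: the number of walks of length
  \<open>k\<close> from \<open>u\<close> to \<open>v\<close>.\<close>

lemma funpow_nbsum_kernel:
  assumes "u \<in> W"
  shows "(nbsum ^^ k) f u = (\<Sum>v\<in>W. (nbsum ^^ k) (\<lambda>y. of_bool (y = v)) u * f v)"
  using assms
proof (induction k arbitrary: u)
  case 0
  then show ?case by (simp add: finite_W of_bool_def if_distrib[of "\<lambda>t. t * _"] cong: if_cong)
next
  case (Suc k)
  have "(nbsum ^^ Suc k) f u = (\<Sum>y \<in> A `` {u}. (nbsum ^^ k) f y)"
    by (simp add: nbsum_def)
  also have "\<dots> = (\<Sum>y \<in> A `` {u}. \<Sum>v\<in>W. (nbsum ^^ k) (\<lambda>y. of_bool (y = v)) y * f v)"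
    using A_sub by (intro sum.cong Suc.IH) auto
  also have "\<dots> = (\<Sum>v\<in>W. (nbsum ^^ Suc k) (\<lambda>y. of_bool (y = v)) u * f v)"
    by (subst sum.swap) (simp add: nbsum_def sum_distrib_right)
  finally show ?case .
qed

text \<open>Self-adjointness tested on the indicators of \<open>u\<close> and
  \<open>v\<close>.\<close>

lemma funpow_nbsum_kernel_commute:
  assumes "u \<in> W" "v \<in> W"
  shows "(nbsum ^^ k) (\<lambda>y. of_bool (y = v)) u = (nbsum ^^ k) (\<lambda>y. of_bool (y = u)) v"
proof -
  have pick: "(\<Sum>x\<in>W. of_bool (x = z) * g x) = g z" "(\<Sum>x\<in>W. g x * of_bool (x = z)) = g z"
    if "z \<in> W" for z and g :: "'b \<Rightarrow> nat"
    using that finite_W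
    by (simp_all add: of_bool_def if_distrib[of "\<lambda>t. t * _"] if_distrib[of "\<lambda>t. _ * t"] cong: if_cong)
  show ?thesis
    using funpow_nbsum_adjoint[of "\<lambda>y. of_bool (y = u)" k "\<lambda>y. of_bool (y = v)"] assms
    by (simp add: pick)
qed

text \<open>Symmetrizing the difference of the two sides turns it into
  \<open>1/2 \<Sum>\<^sub>u\<^sub>v K u v (a u - a v) (b u - b v)\<close> for the symmetric kernel \<open>K\<close> of \<open>nbsum ^^ k\<close>. For trees
  this says that moving all branches from one end of a bare path to the other end does
  not decrease the number of colorings.\<close>

lemma shift_le:
  assumes "up a" "up b"
  shows "(\<Sum>x\<in>W. (nbsum ^^ k) a x * b x) \<le> (\<Sum>x\<in>W. a x * b x * (nbsum ^^ k) (\<lambda>_. 1) x)"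
proof -
  define K where "K u v = (nbsum ^^ k) (\<lambda>y. of_bool (y = v)) u" for u v
  have symK: "K u v = K v u" if "u \<in> W" "v \<in> W" for u v
    using funpow_nbsum_kernel_commute that by (simp add: K_def)
  have ker: "(nbsum ^^ k) f u = (\<Sum>v\<in>W. K u v * f v)" if "u \<in> W" for f u
    unfolding K_def by (rule funpow_nbsum_kernel[OF that])
  have swap: "(\<Sum>u\<in>W. \<Sum>v\<in>W. K u v * g u v) = (\<Sum>u\<in>W. \<Sum>v\<in>W. K u v * g v u)"
    for g :: "'b \<Rightarrow> 'b \<Rightarrow> nat"
    by (subst sum.swap) (auto intro!: sum.cong simp: symK)
  have rearr: "a v * b u + a u * b v \<le> a u * b u + a v * b v" if "u \<in> W" "v \<in> W" for u v
  proof -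
    have "(a u \<le> a v \<and> b u \<le> b v) \<or> (a v \<le> a u \<and> b v \<le> b u)"
      using assms that nat_le_linear[of "\<kappa> u" "\<kappa> v"] by (auto simp: monotone_on_def)
    \<comment> \<open>Both factors have the same sign, since \<open>a\<close> and \<open>b\<close>
      increase along the same \<kappa>. The integers avoid truncated subtraction.\<close>
    then have "0 \<le> (int (a u) - int (a v)) * (int (b u) - int (b v))"
      by (auto simp: zero_le_mult_iff)
    then have "int (a v * b u + a u * b v) \<le> int (a u * b u + a v * b v)"
      by (simp add: algebra_simps)
    then show ?thesis by linarith
  qed
  have L: "(\<Sum>x\<in>W. (nbsum ^^ k) a x * b x) = (\<Sum>u\<in>W. \<Sum>v\<in>W. K u v * (a v * b u))"
    by (simp add: ker sum_distrib_left mult_ac)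
  have R: "(\<Sum>x\<in>W. a x * b x * (nbsum ^^ k) (\<lambda>_. 1) x) = (\<Sum>u\<in>W. \<Sum>v\<in>W. K u v * (a u * b u))"
    by (simp add: ker sum_distrib_left mult_ac)
  have "2 * (\<Sum>u\<in>W. \<Sum>v\<in>W. K u v * (a v * b u))
      = (\<Sum>u\<in>W. \<Sum>v\<in>W. K u v * (a v * b u + a u * b v))"
    using swap[of "\<lambda>u v. a v * b u"] by (simp add: distrib_left sum.distrib)
  also have "\<dots> \<le> (\<Sum>u\<in>W. \<Sum>v\<in>W. K u v * (a u * b u + a v * b v))"
    by (intro sum_mono mult_le_mono2 rearr)
  also have "\<dots> = 2 * (\<Sum>u\<in>W. \<Sum>v\<in>W. K u v * (a u * b u))"
    using swap[of "\<lambda>u v. a u * b u"] by (simp add: distrib_left sum.distrib)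
  finally show ?thesis using L R by simp
qed

section \<open>Counting colorings by the color of the root\<close>

lemma finite_colorings: "finite V \<Longrightarrow> finite (colorings V E)"
  unfolding colorings_def using finite_W by (simp add: finite_PiE)

lemma card_colorings:
  assumes "finite V" "r \<in> V"
  shows "card (colorings V E) = (\<Sum>x\<in>W. rooted_count V E r x)"
proof -
  have "colorings V E = (\<Union>x\<in>W. {f \<in> colorings V E. f r = x})"
    using assms by (auto simp: colorings_def)
  also have "card \<dots> = (\<Sum>x\<in>W. rooted_count V E r x)"
    unfolding rooted_count_def using finite_W finite_colorings[OF assms(1)]
    by (intro card_UN_disjoint) auto
  finally show ?thesis .
qed

lemma rooted_count_singleton:
  assumes "x \<in> W"
  shows "rooted_count {r} {} r x = 1"
proof -
  have "{f \<in> colorings {r} {}. f r = x} = {\<lambda>y\<in>{r}. x}"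
    using assms by (auto simp: colorings_def PiE_def extensional_def fun_eq_iff restrict_def)
  then show ?thesis by (simp add: rooted_count_def)
qed

text \<open>Once \<open>r\<close> has color \<open>x\<close>, the two sides are colored
  independently; the joining edge only forces the color of \<open>s\<close> to be a neighbor of
  \<open>x\<close>.\<close>

lemma rooted_count_join:
  assumes fin: "finite V1" "finite V2" and disj: "V1 \<inter> V2 = {}"
    and E: "E1 \<subseteq> V1 \<times> V1" "E2 \<subseteq> V2 \<times> V2" and rs: "r \<in> V1" "s \<in> V2"
  shows "rooted_count (V1 \<union> V2) (E1 \<union> E2 \<union> {(r, s), (s, r)}) r x =
    rooted_count V1 E1 r x * nbsum (rooted_count V2 E2 s) x"
proof -
  let ?L = "{f \<in> colorings (V1 \<union> V2) (E1 \<union> E2 \<union> {(r, s), (s, r)}). f r = x}"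
  let ?R1 = "{f \<in> colorings V1 E1. f r = x}" and ?R2 = "{f \<in> colorings V2 E2. (x, f s) \<in> A}"
  \<comment> \<open>The inverse of restricting to both sides. Outside both vertex sets it takes the
    value of \<open>g\<close>, which is \<open>undefined\<close> there, so it stays
    extensional.\<close>
  let ?glue = "\<lambda>(f, g) v. if v \<in> V1 then f v else g v"
  have "bij_betw (\<lambda>f. (restrict f V1, restrict f V2)) ?L (?R1 \<times> ?R2)"
  proof (rule bij_betw_byWitness[where f' = ?glue])
    show "\<forall>f\<in>?L. ?glue (restrict f V1, restrict f V2) = f"
      by (auto simp: colorings_def fun_eq_iff PiE_def extensional_def restrict_def)
    show "\<forall>p\<in>?R1 \<times> ?R2. (restrict (?glue p) V1, restrict (?glue p) V2) = p"
      using disj by (auto simp: colorings_def fun_eq_iff PiE_def extensional_def restrict_def)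
    show "(\<lambda>f. (restrict f V1, restrict f V2)) ` ?L \<subseteq> ?R1 \<times> ?R2"
      using E rs by (fastforce simp: colorings_def)
    show "?glue ` (?R1 \<times> ?R2) \<subseteq> ?L"
    proof (rule image_subsetI)
      fix p assume "p \<in> ?R1 \<times> ?R2"
      then obtain f g where p: "p = (f, g)" and f: "f \<in> colorings V1 E1" "f r = x"
        and g: "g \<in> colorings V2 E2" "(f r, g s) \<in> A"
        by auto
      with sym_A have A: "(f r, g s) \<in> A" "(g s, f r) \<in> A" by (auto simp: sym_def)
      have s: "s \<notin> V1" using disj rs by auto
      have "?glue (f, g) \<in> V1 \<union> V2 \<rightarrow>\<^sub>E W"
        using f g by (auto simp: colorings_def PiE_def extensional_def)
      moreover have "(?glue (f, g) u, ?glue (f, g) v) \<in> A"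
        if "(u, v) \<in> E1 \<union> E2 \<union> {(r, s), (s, r)}" for u v
      proof -
        from that consider "u = r" "v = s" | "u = s" "v = r" | "(u, v) \<in> E1" "u \<in> V1" "v \<in> V1"
          | "(u, v) \<in> E2" "u \<notin> V1" "v \<notin> V1"
          using E disj by blast
        then show ?thesis
          using f g A rs s by cases (auto simp: colorings_def)
      qed
      moreover have "?glue (f, g) r = x"
        using f rs by simp
      ultimately show "?glue p \<in> ?L"
        unfolding p colorings_def by blast
    qed
  qed
  then have "card ?L = card ?R1 * card ?R2"
    by (simp add: bij_betw_same_card card_cartesian_product)
  moreover have "?R2 = (\<Union>y \<in> A `` {x}. {f \<in> colorings V2 E2. f s = y})"
    by auto
  then have "card ?R2 = nbsum (rooted_count V2 E2 s) x"
    unfolding nbsum_def rooted_count_def using finite_nb finite_colorings[OF fin(2)]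
    by (simp only:) (intro card_UN_disjoint, auto)
  ultimately show ?thesis by (simp add: rooted_count_def)
qed

section \<open>The lower bound for trees and its equality for paths\<close>

text \<open>The two claims are proved in one induction, for all roots and weights: the bound is
  applied to the parts with the new weights \<open>(nbsum ^^ k) a\<close> and
  \<open>nbsum (\<lambda>x. a x * h1 x)\<close>, and the latter increases only because
  \<open>h1\<close> does.\<close>

lemma bridge_tree_lower_bound:
  assumes "bridge_tree V E" "r \<in> V"
  shows "up (rooted_count V E r)"
    and "up a \<Longrightarrow> (\<Sum>x\<in>W. a x * (nbsum ^^ (card V - 1)) (\<lambda>_. 1) x)
           \<le> (\<Sum>x\<in>W. a x * rooted_count V E r x)"
proof -
  have "up (rooted_count V E r) \<and>
    (\<forall>a. up a \<longrightarrow> (\<Sum>x\<in>W. a x * (nbsum ^^ (card V - 1)) (\<lambda>_. 1) x)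
      \<le> (\<Sum>x\<in>W. a x * rooted_count V E r x))"
    using assms
  proof (induction "card V" arbitrary: V E r rule: less_induct)
    case less
    show ?case
    proof (cases "V = {r}")
      case True
      \<comment> \<open>A loop is never a bridge, since the closure is reflexive.\<close>
      have "E = {}"
        using less.prems True by (force simp: bridge_tree_def)
      with True show ?thesis by (simp add: rooted_count_singleton monotone_on_def)
    next
      case False
      obtain V1 E1 V2 E2 s where T: "bridge_tree V1 E1" "bridge_tree V2 E2" and
        V: "V1 \<inter> V2 = {}" "V = V1 \<union> V2" and E: "E = E1 \<union> E2 \<union> {(r, s), (s, r)}" and
        rs: "r \<in> V1" "s \<in> V2"
        by (rule bridge_tree_split[OF less.prems False])
      have fin: "finite V1" "finite V2" and sub: "E1 \<subseteq> V1 \<times> V1" "E2 \<subseteq> V2 \<times> V2"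
        using T by (auto simp: bridge_tree_def)
      define h1 h2 k where "h1 = rooted_count V1 E1 r" and "h2 = rooted_count V2 E2 s"
        and "k = card V2"
      have k: "k > 0" "card V1 > 0" "card V = k + card V1"
        using fin V rs by (auto simp: k_def card_gt_0_iff card_Un_disjoint)
      have h: "rooted_count V E r x = h1 x * nbsum h2 x" for x
        unfolding V(2) E h1_def h2_def by (rule rooted_count_join[OF fin V(1) sub rs])
      have "card V1 < card V" "card V2 < card V" using k by (simp_all add: k_def)
      note IH1 = less.hyps[OF this(1) T(1) rs(1), folded h1_def]
        and IH2 = less.hyps[OF this(2) T(2) rs(2), folded h2_def k_def]
      have "up (rooted_count V E r)"
        unfolding h using IH1 IH2 by (intro up_mult up_nbsum) auto
      moreover have "(\<Sum>x\<in>W. a x * (nbsum ^^ (card V - 1)) (\<lambda>_. 1) x)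
        \<le> (\<Sum>x\<in>W. a x * rooted_count V E r x)" if a: "up a" for a
      proof -
        \<comment> \<open>The exponent counts edges: \<open>k\<close> covers the
          \<open>k - 1\<close> edges of the second part and the joining edge, which
          \<open>Suc\<close> splits off again below.\<close>
        have exp: "card V - 1 = k + (card V1 - 1)" "k = Suc (k - 1)" using k by auto
        have ah: "up (\<lambda>x. a x * h1 x)" using a IH1 by (intro up_mult) auto
        have "(\<Sum>x\<in>W. a x * (nbsum ^^ (card V - 1)) (\<lambda>_. 1) x)
          = (\<Sum>x\<in>W. (nbsum ^^ k) a x * (nbsum ^^ (card V1 - 1)) (\<lambda>_. 1) x)"
          by (simp only: exp(1) funpow_add o_apply funpow_nbsum_adjoint)
        also have "\<dots> \<le> (\<Sum>x\<in>W. (nbsum ^^ k) a x * h1 x)"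
          using IH1 up_funpow_nbsum[OF a] by blast
        also have "\<dots> \<le> (\<Sum>x\<in>W. a x * h1 x * (nbsum ^^ k) (\<lambda>_. 1) x)"
          using a IH1 by (intro shift_le) auto
        also have "\<dots> = (\<Sum>x\<in>W. nbsum (\<lambda>x. a x * h1 x) x * (nbsum ^^ (k - 1)) (\<lambda>_. 1) x)"
          by (subst exp(2)) (simp add: nbsum_adjoint)
        also have "\<dots> \<le> (\<Sum>x\<in>W. nbsum (\<lambda>x. a x * h1 x) x * h2 x)"
          using IH2 up_nbsum[OF ah] by blast
        also have "\<dots> = (\<Sum>x\<in>W. a x * rooted_count V E r x)"
          by (simp add: h nbsum_adjoint[symmetric] mult.assoc)
        finally show ?thesis .
      qed
      ultimately show ?thesis by blast
    qed
  qed
  then show "up (rooted_count V E r)"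
    and "up a \<Longrightarrow> (\<Sum>x\<in>W. a x * (nbsum ^^ (card V - 1)) (\<lambda>_. 1) x)
           \<le> (\<Sum>x\<in>W. a x * rooted_count V E r x)"
    by blast+
qed

text \<open>Rooting at the last vertex makes each extension a join of a new one-vertex root with the
  shorter path.\<close>

lemma rooted_count_path:
  assumes "x \<in> W"
  shows "rooted_count {..n} (parcs (path_graph (Suc n))) n x = (nbsum ^^ n) (\<lambda>_. 1) x"
  using assms
proof (induction n arbitrary: x)
  case 0
  have "{..0::nat} = {0}" "parcs (path_graph (Suc 0)) = {}" by (auto simp: path_graph_def)
  with 0 show ?case by (simp add: rooted_count_singleton)
next
  case (Suc n)
  have "{..Suc n} = {Suc n} \<union> {..n}" by auto
  moreover have "parcs (path_graph (Suc (Suc n))) =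
    {} \<union> parcs (path_graph (Suc n)) \<union> {(Suc n, n), (n, Suc n)}"
    by (auto simp: path_graph_def)
  moreover have "parcs (path_graph (Suc n)) \<subseteq> {..n} \<times> {..n}"
    by (auto simp: path_graph_def)
  ultimately have "rooted_count {..Suc n} (parcs (path_graph (Suc (Suc n)))) (Suc n) x =
    rooted_count {Suc n} {} (Suc n) x * nbsum (rooted_count {..n} (parcs (path_graph (Suc n))) n) x"
    by (simp only:) (rule rooted_count_join, auto)
  also have "nbsum (rooted_count {..n} (parcs (path_graph (Suc n))) n) = nbsum ((nbsum ^^ n) (\<lambda>_. 1))"
    using Suc.IH by (rule nbsum_cong)
  finally show ?case using Suc.prems by (simp add: rooted_count_singleton)
qed

lemma card_colorings_path_le:
  assumes T: "bridge_tree {..<n} E" and n: "n \<ge> 1"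
  shows "card (colorings {..<n} (parcs (path_graph n))) \<le> card (colorings {..<n} E)"
proof -
  obtain m where m: "n = Suc m" using n by (cases n) auto
  have "card (colorings {..<n} (parcs (path_graph n))) = (\<Sum>x\<in>W. (nbsum ^^ m) (\<lambda>_. 1) x)"
    using rooted_count_path by (subst card_colorings[of _ m]) (auto simp: m lessThan_Suc_atMost)
  \<comment> \<open>Weight constantly 1. Vertex \<open>m\<close> is an end of the path, but may sit
    anywhere in the tree.\<close>
  also have "\<dots> \<le> (\<Sum>x\<in>W. rooted_count {..<n} E m x)"
    using bridge_tree_lower_bound(2)[OF T, of m "\<lambda>_. 1"] m by (simp add: monotone_on_def)
  also have "\<dots> = card (colorings {..<n} E)"
    using m by (subst card_colorings[of _ m]) auto
  finally show ?thesis .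
qed

end

section \<open>From the similarity matrix to an ordered target\<close>

lemma ordered_target_if_increasing_columns:
  assumes H: "pair_pseudo_graph H" and Hs: "class_ordering H Hs"
    and inc: "increasing_columns (similarity_matrix H Hs)"
  shows "\<exists>\<kappa>. ordered_target (pverts H) (parcs H) \<kappa>"
proof -
  interpret pair_pseudo_graph H by (rule H)
  have wf: "pair_wf_digraph H" by unfold_locales
  note eqv = equiv_similarity[OF wf]
  let ?n = "length Hs"
  have Hs': "distinct Hs" "set Hs = pverts H // similarity H"
    using Hs by (auto simp: class_ordering_def similarity_classes_def)
  \<comment> \<open>The index is unique because the classes partition the vertices.\<close>
  define \<kappa> where "\<kappa> v = (THE i. i < ?n \<and> v \<in> Hs ! i)" for v
  have Hs_sub: "Hs ! i \<subseteq> pverts H" if "i < ?n" for i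
    using in_quotient_imp_subset[OF eqv] nth_mem[OF that] Hs'(2) by blast
  have disj: "i = j" if "i < ?n" "j < ?n" "v \<in> Hs ! i" "v \<in> Hs ! j" for i j v
  proof -
    have "Hs ! i = Hs ! j"
      using quotient_disj[OF eqv] nth_mem that(1,2) that(3,4) Hs'(2) by blast
    with that Hs'(1) show ?thesis by (simp add: nth_eq_iff_index_eq)
  qed
  have \<kappa>_eq: "\<kappa> v = i" if "i < ?n" "v \<in> Hs ! i" for i v
    unfolding \<kappa>_def using that disj by blast
  have \<kappa>: "\<kappa> v < ?n" "v \<in> Hs ! \<kappa> v" if "v \<in> pverts H" for v
  proof -
    have "v \<in> \<Union> (set Hs)" using that Union_quotient[OF eqv] Hs'(2) by simp
    then obtain i where "i < ?n" "v \<in> Hs ! i" by (auto simp: in_set_conv_nth)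
    with \<kappa>_eq show "\<kappa> v < ?n" "v \<in> Hs ! \<kappa> v" by auto
  qed
  let ?M = "similarity_matrix H Hs"
  \<comment> \<open>The classes from position \<open>c\<close> on split the counted neighbors, so a
    tail of a matrix row is a tail count.\<close>
  have tail: "card {w \<in> parcs H `` {v}. c \<le> \<kappa> w} = (\<Sum>j = c..<?n. ?M $$ (\<kappa> v, j))"
    if v: "v \<in> pverts H" for v c
  proof -
    have "{w \<in> parcs H `` {v}. c \<le> \<kappa> w} = (\<Union>j\<in>{c..<?n}. {w \<in> Hs ! j. (v, w) \<in> parcs H})"
      using \<kappa>[OF in_arcsD2] \<kappa>_eq by (auto intro!: bexI[of _ "\<kappa> _"])
    also have "card \<dots> = (\<Sum>j = c..<?n. card {w \<in> Hs ! j. (v, w) \<in> parcs H})"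
      using disj finite_subset[OF Hs_sub finite_verts] by (intro card_UN_disjoint) auto
    also have "\<dots> = (\<Sum>j = c..<?n. ?M $$ (\<kappa> v, j))"
      using \<kappa>[OF v] by (intro sum.cong) (auto simp: similarity_matrix_entry[OF H Hs] neighbors_in_def)
    finally show ?thesis .
  qed
  have "dim_row ?M = ?n" by (simp add: similarity_matrix_def)
  \<comment> \<open>For \<open>c\<close> beyond the last column both sums are empty.\<close>
  with inc have le_Suc: "(\<Sum>j = c..<?n. ?M $$ (i, j)) \<le> (\<Sum>j = c..<?n. ?M $$ (Suc i, j))"
    if "Suc i < ?n" for c i
    using that by (cases "c < ?n") (auto simp: increasing_columns_def)
  have mono: "(\<Sum>j = c..<?n. ?M $$ (i, j)) \<le> (\<Sum>j = c..<?n. ?M $$ (i', j))"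
    if "i \<le> i'" "i' < ?n" for c i i'
    using that
  proof (induction i' rule: dec_induct)
    case (step m)
    then show ?case using le_Suc[of m c] by simp
  qed simp
  have "ordered_target (pverts H) (parcs H) \<kappa>"
  proof
    show "sym (parcs H)" using arcs_symmetric by (auto intro: symI)
    fix u v c assume uv: "u \<in> pverts H" "v \<in> pverts H" "\<kappa> u \<le> \<kappa> v"
    then show "card {w \<in> parcs H `` {u}. c \<le> \<kappa> w} \<le> card {w \<in> parcs H `` {v}. c \<le> \<kappa> w}"
      unfolding tail[OF uv(1)] tail[OF uv(2)] using mono \<kappa> by blast
  qed (auto dest: in_arcsD1 in_arcsD2)
  then show ?thesis by blast
qed

theorem theorem1p5:
  fixes H :: "'a pair_pre_digraph"
  assumes "pair_pseudo_graph H"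
    and "\<exists>Hs. class_ordering H Hs \<and> increasing_columns (similarity_matrix H Hs)"
  shows "hoffman_london H"
proof -
  obtain \<kappa> where "ordered_target (pverts H) (parcs H) \<kappa>"
    using assms ordered_target_if_increasing_columns by blast
  then interpret ordered_target "pverts H" "parcs H" \<kappa> .
  have hom: "hom_count G H = card (colorings (pverts G) (parcs G))" for G :: "nat pair_pre_digraph"
    by (simp add: hom_count_def H_colorings_def colorings_def)
  show ?thesis
    unfolding hoffman_london_def
  proof (intro allI impI)
    fix n :: nat assume n: "n \<ge> 1"
    have "hom_count (path_graph n) H \<le> hom_count T H" if "T \<in> trees n" for T
    proof -
      have "bridge_tree {..<n} (parcs T)" "pverts T = {..<n}"
        using that undirected_tree_bridge_tree[of T] by (auto simp: trees_def)
      then show ?thesis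
        using card_colorings_path_le[OF _ n] by (simp add: hom path_graph_def)
    qed
    \<comment> \<open>The path is itself one of the trees, so the bound is attained.\<close>
    then show "hom_count (path_graph n) H = Min ((\<lambda>T. hom_count T H) ` trees n)"
      using path_graph_in_trees[OF n] finite_trees by (intro Min_eqI[symmetric]) auto
  qed
qed

end
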